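(* Let $n\ge 3$, let $F$ be a field, let $1\le j\le n$, and let $P_j\in M_{c_n-1}(F)$ be the permutation matrix, with associated permutation $\sigma_j\in\mathfrak S_{c_n-1}$, of the multiplication map $m_{x_j}$ on $\mathcal B'$ attached to the ideal $I_n$. Then $\sigma_j$ decomposes into exactly $2^{n-2}$ disjoint cycles, each of length $2(n-2)$. Consequently, the order and the characteristic polynomial of $P_j$ are $$\operatorname{Ord}(P_j)=2(n-2)\qquad\text{and}\qquad \chi_{P_j}(t)=\big(t^{2(n-2)}-1\big)^{2^{n-2}}.$$
   Context: $I_n\subset R_n=F[x_1,\dots,x_n]$ is the ideal generated by the $n$ binomials $\prod_{k\ne i}x_k-x_i$, $1\le i\le n$, and $c_n=1+(n-2)2^{n-1}=\dim_F R_n/I_n$. The monomial basis $\mathcal B$ of $R_n/I_n$ (for the lexicographic order with $x_1>\cdots>x_n$) consists of the classes of the monomials $m(b,T)=x_n^b\prod_{i\in T}x_i$ with $T\subseteq\{2,\dots,n-1\}$ and $0\le b<2n-4$, together with $m(2n-4,\emptyset)=x_n^{2n-4}$. Put $\mathcal B'=\mathcal B\setminus\{1\}=\{m_1,\dots,m_{c_n-1}\}$. Multiplication by $x_j$ in $R_n/I_n$, denoted $m_{x_j}$, permutes $\mathcal B'$; $\sigma_j$ is the permutation defined by $x_j\cdot m_r=m_{\sigma_j(r)}$ in $R_n/I_n$, and $P_j$ is the corresponding permutation matrix, $(P_j)_{r\ell}=1$ if $\ell=\sigma_j(r)$ and $0$ otherwise. *)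

theory Defs
  imports
    "HOL-Library.Poly_Mapping"
    "HOL-Algebra.QuotRing"
    "HOL-Algebra.Multiplicative_Group"
    "HOL-Combinatorics.Cycles"
    "Jordan_Normal_Form.Char_Poly"
begin

text \<open>A monomial is its exponent function of type \<^typ>\<open>nat \<Rightarrow>\<^sub>0 nat\<close>. The type below has a
  variable for every natural number; \<open>poly_ring n\<close> cuts it down to the variables
  \<open>1, \<dots>, n\<close>.\<close>

type_synonym 'a mpoly = "(nat \<Rightarrow>\<^sub>0 nat) \<Rightarrow>\<^sub>0 'a"

definition poly_ring :: "nat \<Rightarrow> 'a::field mpoly ring" where
  "poly_ring n =
     \<lparr>carrier = {p. \<forall>u \<in> Poly_Mapping.keys p. Poly_Mapping.keys u \<subseteq> {1..n}},
      monoid.mult = (*), one = 1, zero = 0, add = (+)\<rparr>"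

definition X :: "nat \<Rightarrow> 'a::field mpoly" where
  "X i = Poly_Mapping.single (Poly_Mapping.single i 1) 1"

definition I_ideal :: "nat \<Rightarrow> 'a::field mpoly set" where
  "I_ideal n =
     Idl\<^bsub>poly_ring n\<^esub> {(\<Prod>k\<in>{1..n} - {i}. X k) - X i |i. i \<in> {1..n}}"

definition quot_ring :: "nat \<Rightarrow> 'a::field mpoly set ring" where
  "quot_ring n = poly_ring n Quot I_ideal n"

definition cls :: "nat \<Rightarrow> 'a::field mpoly \<Rightarrow> 'a mpoly set" where
  "cls n p = I_ideal n +>\<^bsub>poly_ring n\<^esub> p"

definition basis_monomial :: "nat \<Rightarrow> nat \<Rightarrow> nat set \<Rightarrow> 'a::field mpoly" where
  "basis_monomial n b T = X n ^ b * (\<Prod>i\<in>T. X i)"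

definition B :: "nat \<Rightarrow> 'a::field mpoly set set" where
  "B n = {cls n (basis_monomial n b T) |b T. T \<subseteq> {2..n-1} \<and> b < 2*n-4}
         \<union> {cls n (basis_monomial n (2*n-4) {})}"

definition B' :: "nat \<Rightarrow> 'a::field mpoly set set" where
  "B' n = B n - {cls n 1}"

definition c :: "nat \<Rightarrow> nat" where
  "c n = 1 + (n-2) * 2^(n-1)"

definition mult_map :: "nat \<Rightarrow> nat \<Rightarrow> 'a::field mpoly set \<Rightarrow> 'a mpoly set" where
  "mult_map n j q = cls n (X j) \<otimes>\<^bsub>quot_ring n\<^esub> q"

text \<open>Matrix indices start at 0 in the matrix library, so \<open>B' n\<close> is enumerated as
  \<open>m 0, \<dots>, m (c n - 2)\<close>. Outside these indices \<open>\<sigma>\<close> is the identity, as the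
  predicate \<open>permutes\<close> requires.\<close>

definition \<sigma> :: "nat \<Rightarrow> (nat \<Rightarrow> 'a::field mpoly set) \<Rightarrow> nat \<Rightarrow> nat \<Rightarrow> nat" where
  "\<sigma> n m j r =
     (if r < c n - 1 then THE l. l < c n - 1 \<and> mult_map n j (m r) = m l else r)"

definition P :: "nat \<Rightarrow> (nat \<Rightarrow> 'a::field mpoly set) \<Rightarrow> nat \<Rightarrow> 'a mat" where
  "P n m j = mat (c n - 1) (c n - 1) (\<lambda>(r, l). if l = \<sigma> n m j r then 1 else 0)"

text \<open>The cycles are given by lists of their elements. They cover \<open>S\<close>, so that a fixed point
  would count as a cycle of length 1.\<close>

definition disjoint_cycles :: "'b set \<Rightarrow> ('b \<Rightarrow> 'b) \<Rightarrow> 'b list list \<Rightarrow> bool" where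
  "disjoint_cycles S p css \<longleftrightarrow>
     [] \<notin> set css \<and> distinct (concat css) \<and> set (concat css) = S \<and>
     p = foldr (\<circ>) (map cycle_of_list css) id"

definition mat_order :: "nat \<Rightarrow> 'a::field mat \<Rightarrow> nat" where
  "mat_order N A = group.ord (units_of (ring_mat TYPE('a) N ())) A"

end

theory Submission
  imports Defs
begin

text \<open>
  Write \<open>x\<^sub>i\<close> for the class of the variable \<open>X i\<close>. Multiplying the relation
  \<open>x\<^sub>i = \<Prod>\<^bsub>k \<noteq> i\<^esub> x\<^sub>k\<close> by \<open>x\<^sub>i\<close> shows that all squares \<open>x\<^sub>i\<^sup>2\<close> equal one element
  \<open>y = x\<^sub>1 \<cdots> x\<^sub>n\<close>. If the relation for \<open>x\<^sub>k\<close> is substituted into the one for \<open>x\<^sub>i\<close>, the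
  other \<open>n - 2\<close> variables are squared, and \<open>x\<^sub>i = x\<^sub>i y\<^bsup>n-2\<^esup>\<close> results (\<open>y_power_fixes_x\<close>). So \<open>e = y\<^bsup>n-2\<^esup>\<close> acts as the identity on
  all monomials except 1. Each such monomial has a square that is a power of \<open>y\<close>, hence it is
  invertible with respect to \<open>e\<close> (\<open>monomial_inverse\<close>). Therefore the classes of the nontrivial
  monomials form a finite abelian group with identity \<open>e\<close>, and \<open>B' n\<close> is the set of its
  elements: \<open>x\<^sub>1 = x\<^sub>2 \<cdots> x\<^sub>n\<close> eliminates \<open>x\<^sub>1\<close>, the squares of \<open>x\<^sub>2, \<dots>, x\<^bsub>n-1\<^esub>\<close> are absorbed into
  \<open>x\<^sub>n\<close>, and \<open>x\<^sub>n\<close> has period \<open>2(n-2)\<close> (\<open>nontrivial_params\<close>).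

  Multiplication by \<open>x\<^sub>j\<close> is a translation of this group, so all its cycles have the order of \<open>x\<^sub>j\<close>
  as their length. This order divides \<open>2(n-2)\<close> because \<open>x\<^sub>j\<^sup>2 = y\<close> (\<open>x_period\<close>). For
  \<open>0 < k < 2(n-2)\<close> the power \<open>x\<^sub>j\<^sup>k\<close> has a normal form different from
  \<open>e = x\<^sub>n\<^bsup>2n-4\<^esup>\<close> (\<open>x_power_normal_form\<close>), so the order is exactly \<open>2(n-2)\<close>
  (\<open>x_power_moves\<close>). The last step needs that different normal forms have different classes.
  The enumeration \<open>m\<close> provides this: it says that \<open>B' n\<close> has \<open>c n - 1\<close> elements, which is the
  number of normal forms other than 1.

  The rest is about permutation matrices. The powers of the matrix belong to the powers of the
  permutation, which gives the order. Listing the indices cycle by cycle conjugates the matrix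
  into a block-diagonal one whose blocks are single cycles of length \<open>N = 2(n-2)\<close>, each with
  characteristic polynomial \<open>t\<^sup>N - 1\<close> (\<open>char_poly_perm_mat_disjoint_cycles\<close>).
\<close>

section \<open>Permutations all of whose cycles have the same length\<close>

lemma foldr_cycles_outside:
  assumes "y \<notin> set (concat css)"
  shows "foldr (\<circ>) (map cycle_of_list css) id y = y"
  using assms by (induction css) (auto simp: id_outside_supp)

text \<open>The cycles behind \<open>cs\<close> in the list fix \<open>y\<close>, and those before it fix the image of \<open>y\<close>.\<close>

lemma foldr_cycles_apply:
  assumes "distinct (concat css)" "cs \<in> set css" "y \<in> set cs"
  shows "foldr (\<circ>) (map cycle_of_list css) id y = cycle_of_list cs y"
  using assms
proof (induction css)
  case (Cons ds css)
  show ?case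
  proof (cases "cs = ds")
    case True
    then have "y \<notin> set (concat css)"
      using Cons.prems by auto
    then have "foldr (\<circ>) (map cycle_of_list css) id y = y"
      by (rule foldr_cycles_outside)
    moreover have "foldr (\<circ>) (map cycle_of_list (ds # css)) id y =
        cycle_of_list ds (foldr (\<circ>) (map cycle_of_list css) id y)"
      by simp
    ultimately show ?thesis
      by (simp only: True)
  next
    case False
    then have cs: "cs \<in> set css" using Cons.prems by auto
    then have "cycle_of_list cs y \<in> set cs"
      using Cons.prems permutes_in_image[OF cycle_permutes] by metis
    then have "cycle_of_list cs y \<notin> set ds"
      using cs Cons.prems by auto
    then show ?thesis
      using Cons cs by (simp add: id_outside_supp)
  qed
qed simp

text \<open>An orbit is split off a set closed under \<open>p\<close> and the complement is again closed. The
  permutation itself stays fixed during the induction; only the closed set shrinks.\<close>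

lemma free_closed_set_is_union_of_supports:
  assumes "permutation p" and "finite S" and "p ` S \<subseteq> S"
  shows "\<exists>xs. set xs \<subseteq> S \<and> distinct (concat (map (support p) xs)) \<and>
    set (concat (map (support p) xs)) = S"
  using assms(2,3)
proof (induction "card S" arbitrary: S rule: less_induct)
  case less
  show ?case
  proof (cases "S = {}")
    case True
    then show ?thesis by (intro exI[of _ "[]"]) simp
  next
    case False
    then obtain x where x: "x \<in> S" by blast
    define C where "C = set (support p x)"
    have C: "C = range (\<lambda>i. (p ^^ i) x)"
      unfolding C_def by (rule support_set[OF assms(1)])
    have "(p ^^ i) x \<in> S" for i
      using x less.prems(2) by (induction i) auto
    then have CS: "C \<subseteq> S" unfolding C by auto
    have xC: "x \<in> C" unfolding C using rangeI[of "\<lambda>i. (p ^^ i) x" 0] by simp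
    have closed: "p ` (S - C) \<subseteq> S - C"
    proof clarify
      fix y assume y: "y \<in> S" "y \<notin> C"
      have "p y \<notin> C"
      proof
        assume "p y \<in> C"
        moreover have "p y \<in> set (support p y)"
          unfolding support_set[OF assms(1)] using rangeI[of "\<lambda>i. (p ^^ i) y" 1] by simp
        ultimately have "set (support p y) \<inter> set (support p x) \<noteq> {}"
          unfolding C_def by blast
        then have "y \<in> C"
          unfolding C_def using disjoint_support'[OF assms(1)] by blast
        then show False using y by blast
      qed
      then show "p y \<in> S - C" using y less.prems by auto
    qed
    have "card (S - C) < card S"
      using less.prems(1) x xC by (intro psubset_card_mono) auto
    then obtain xs where xs: "set xs \<subseteq> S - C" "distinct (concat (map (support p) xs))"
        "set (concat (map (support p) xs)) = S - C"
      using less.hyps[of "S - C"] closed less.prems(1) by blast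
    show ?thesis
    proof (intro exI[of _ "x # xs"] conjI)
      show "set (x # xs) \<subseteq> S" using xs x by auto
      have "distinct (support p x)" by (rule cycle_of_permutation[OF assms(1)])
      moreover have "set (support p x) \<inter> set (concat (map (support p) xs)) = {}"
        unfolding xs(3) C_def[symmetric] by blast
      ultimately show "distinct (concat (map (support p) (x # xs)))"
        using xs(2) by simp
      have "set (concat (map (support p) (x # xs))) = C \<union> set (concat (map (support p) xs))"
        by (simp add: C_def)
      then show "set (concat (map (support p) (x # xs))) = S"
        using xs(3) CS by blast
    qed
  qed
qed

text \<open>The freeness condition says that every point of \<open>S\<close> has least period \<open>N\<close>, so all orbits
  in the decomposition have exactly \<open>N\<close> points.\<close>

lemma free_permutation_cycles:
  assumes "p permutes S" and "finite S" and "0 < N"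
    and free: "\<And>x k. x \<in> S \<Longrightarrow> (p ^^ k) x = x \<longleftrightarrow> N dvd k"
  shows "\<exists>css. disjoint_cycles S p css \<and> N * length css = card S \<and>
    (\<forall>cs \<in> set css. length cs = N)"
proof -
  have perm: "permutation p"
    using assms(1,2) by (auto simp: permutation_permutes)
  have "p ` S \<subseteq> S"
    using permutes_image[OF assms(1)] by simp
  then obtain xs where xs: "set xs \<subseteq> S" "distinct (concat (map (support p) xs))"
      "set (concat (map (support p) xs)) = S"
    using free_closed_set_is_union_of_supports[OF perm assms(2)] by blast
  define css where "css = map (support p) xs"
  have lp: "least_power p x = N" if "x \<in> S" for x
    using free[OF that] least_power_dvd[OF perm, of x] by (metis dvd_antisym dvd_refl)
  have len: "\<forall>cs \<in> set css. length cs = N"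
    using lp xs(1) by (auto simp: css_def)
  have "foldr (\<circ>) (map cycle_of_list css) id y = p y" for y
  proof (cases "y \<in> S")
    case True
    then obtain x where x: "x \<in> set xs" "y \<in> set (support p x)"
      using xs(3) by auto
    then have "foldr (\<circ>) (map cycle_of_list css) id y = cycle_of_list (support p x) y"
      using xs(2) unfolding css_def by (intro foldr_cycles_apply) auto
    then show ?thesis
      using cycle_restrict[OF perm x(2)] by simp
  next
    case False
    then have "foldr (\<circ>) (map cycle_of_list css) id y = y"
      using xs(3) unfolding css_def by (intro foldr_cycles_outside) metis
    then show ?thesis
      using False assms(1) by (simp add: permutes_def)
  qed
  then have "p = foldr (\<circ>) (map cycle_of_list css) id" by auto
  moreover have "[] \<notin> set css" using len assms(3) by auto
  ultimately have "disjoint_cycles S p css"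
    using xs(2,3) unfolding disjoint_cycles_def css_def by blast
  moreover have "card S = N * length css"
  proof -
    have "card S = length (concat css)"
      using xs(2,3) unfolding css_def by (metis distinct_card)
    also have "\<dots> = sum_list (map length css)"
      by (simp add: length_concat)
    also have "map length css = map (\<lambda>_. N) css"
      using len by simp
    also have "sum_list (map (\<lambda>_. N) css) = N * length css"
      by (simp add: sum_list_triv)
    finally show ?thesis .
  qed
  ultimately show ?thesis using len by metis
qed

section \<open>Permutation matrices\<close>

text \<open>Rows are mapped to columns by \<open>p\<close>, as for \<open>P\<close>. With this convention products come out in
  reverse order, see \<open>perm_mat_mult\<close>.\<close>

definition perm_mat :: "nat \<Rightarrow> (nat \<Rightarrow> nat) \<Rightarrow> 'a::comm_ring_1 mat" where
  "perm_mat M p = mat M M (\<lambda>(r, l). if l = p r then 1 else 0)"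

lemma perm_mat_carrier [simp]: "perm_mat M p \<in> carrier_mat M M"
  by (simp add: perm_mat_def)

lemma perm_mat_cong: "(\<And>r. r < M \<Longrightarrow> p r = q r) \<Longrightarrow> perm_mat M p = perm_mat M q"
  by (rule eq_matI) (auto simp: perm_mat_def)

lemma perm_mat_mult:
  assumes "\<And>r. r < M \<Longrightarrow> p r < M"
  shows "perm_mat M p * perm_mat M q = (perm_mat M (q \<circ> p) :: 'a::comm_ring_1 mat)"
proof (rule eq_matI)
  fix r l assume "r < dim_row (perm_mat M (q \<circ> p) :: 'a mat)"
    and "l < dim_col (perm_mat M (q \<circ> p) :: 'a mat)"
  then have rl: "r < M" "l < M" by (auto simp: perm_mat_def)
  have "(perm_mat M p * perm_mat M q :: 'a mat) $$ (r, l) =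
      (\<Sum>k\<in>{0..<M}. (if k = p r then 1 else 0) * (if l = q k then 1 else 0))"
    using rl by (auto simp: perm_mat_def scalar_prod_def intro!: sum.cong)
  also have "\<dots> = (\<Sum>k\<in>{0..<M}. if k = p r then (if l = q k then 1 else 0) else 0)"
    by (intro sum.cong) auto
  also have "\<dots> = (if l = q (p r) then 1 else 0)"
    using assms[OF rl(1)] by simp
  finally show "(perm_mat M p * perm_mat M q :: 'a mat) $$ (r, l) = perm_mat M (q \<circ> p) $$ (r, l)"
    using rl by (simp add: perm_mat_def)
qed (auto simp: perm_mat_def)

lemma perm_mat_id: "(\<And>r. r < M \<Longrightarrow> p r = r) \<Longrightarrow> perm_mat M p = 1\<^sub>m M"
  by (rule eq_matI) (auto simp: perm_mat_def)

lemma perm_mat_eq_one_iff: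
  assumes "\<And>r. r < M \<Longrightarrow> p r < M"
  shows "(perm_mat M p :: 'a::comm_ring_1 mat) = 1\<^sub>m M \<longleftrightarrow> (\<forall>r<M. p r = r)"
proof (intro iffI allI impI)
  fix r assume *: "(perm_mat M p :: 'a mat) = 1\<^sub>m M" and r: "r < M"
  have "(perm_mat M p :: 'a mat) $$ (r, p r) = 1"
    using r assms[OF r] by (simp add: perm_mat_def)
  then show "p r = r"
    unfolding * using r assms[OF r] by (simp split: if_splits)
qed (simp add: perm_mat_id)

lemma ring_mat_power_perm_mat:
  assumes "\<And>r. r < M \<Longrightarrow> p r < M"
  shows "(perm_mat M p :: 'a::comm_ring_1 mat) [^]\<^bsub>ring_mat TYPE('a) M ()\<^esub> (k::nat) = perm_mat M (p ^^ k)"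
proof (induction k)
  case 0
  show ?case by (simp add: ring_mat_simps perm_mat_id)
next
  case (Suc k)
  have "(p ^^ k) r < M" if "r < M" for r
    using that assms by (induction k) auto
  then show ?case
    using Suc by (simp add: ring_mat_simps perm_mat_mult comp_def)
qed

lemma perm_mat_in_Units:
  assumes "p permutes {..<M}"
  shows "(perm_mat M p :: 'a::comm_ring_1 mat) \<in> Units (ring_mat TYPE('a) M ())"
proof -
  have q: "Hilbert_Choice.inv p permutes {..<M}" by (rule permutes_inv[OF assms])
  have "r < M \<Longrightarrow> p r < M" "r < M \<Longrightarrow> Hilbert_Choice.inv p r < M" for r
    using permutes_in_image[OF assms, of r] permutes_in_image[OF q, of r] by auto
  then have "perm_mat M (Hilbert_Choice.inv p) * perm_mat M p = (1\<^sub>m M :: 'a mat)"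
    "perm_mat M p * perm_mat M (Hilbert_Choice.inv p) = (1\<^sub>m M :: 'a mat)"
    using permutes_inverses[OF assms] by (auto simp: perm_mat_mult intro!: perm_mat_id)
  then show ?thesis
    unfolding Units_def ring_mat_simps by (auto intro!: bexI[of _ "perm_mat M (Hilbert_Choice.inv p)"])
qed

lemma mat_order_perm_mat:
  assumes "p permutes {..<M}" and "0 < M"
    and free: "\<And>r k. r < M \<Longrightarrow> (p ^^ k) r = r \<longleftrightarrow> N dvd k"
  shows "mat_order M (perm_mat M p :: 'a::field mat) = N"
proof -
  let ?R = "ring_mat TYPE('a) M ()"
  interpret R: semiring ?R by (rule semiring_mat)
  interpret U: group "units_of ?R" by (rule R.units_group)
  have lt: "r < M \<Longrightarrow> p r < M" for r
    using permutes_in_image[OF assms(1), of r] by auto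
  have P: "(perm_mat M p :: 'a mat) \<in> Units ?R"
    by (rule perm_mat_in_Units[OF assms(1)])
  have pow: "(perm_mat M p :: 'a mat) [^]\<^bsub>units_of ?R\<^esub> k = perm_mat M (p ^^ k)" for k :: nat
    using R.units_of_pow[OF P, of k] ring_mat_power_perm_mat[OF lt, where ?'a = 'a] by simp
  have "(p ^^ k) r < M" if "r < M" for r k
    using that lt by (induction k) auto
  then have "(perm_mat M (p ^^ k) :: 'a mat) = 1\<^sub>m M \<longleftrightarrow> N dvd k" for k
    using perm_mat_eq_one_iff[of M "p ^^ k"] free assms(2) by blast
  then show ?thesis
    unfolding mat_order_def using U.ord_unique[of "perm_mat M p" N] P pow
    by (simp add: units_of_carrier units_of_one ring_mat_simps)
qed

text \<open>Conjugate permutations have similar matrices; \<open>f\<close> is a relabelling of the indices.\<close>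

lemma similar_perm_mat:
  assumes bij: "bij_betw f {..<M} {..<M}"
    and lt: "\<And>r. r < M \<Longrightarrow> p r < M" "\<And>r. r < M \<Longrightarrow> q r < M"
    and conj: "\<And>r. r < M \<Longrightarrow> p (f r) = f (q r)"
  shows "similar_mat (perm_mat M q) (perm_mat M p :: 'a::comm_ring_1 mat)"
proof -
  define g where "g = inv_into {..<M} f"
  have gf: "g (f r) = r" and fg: "f (g r) = r" and flt: "f r < M" and glt: "g r < M"
    if "r < M" for r
    using that bij_betw_inv_into_left[OF bij] bij_betw_inv_into_right[OF bij]
      bij_betwE[OF bij] bij_betwE[OF bij_betw_inv_into[OF bij]]
    by (auto simp: g_def)
  have inverse: "perm_mat M f * perm_mat M g = (1\<^sub>m M :: 'a mat)"
    "perm_mat M g * perm_mat M f = (1\<^sub>m M :: 'a mat)"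
    by (auto simp: perm_mat_mult flt glt gf fg intro!: perm_mat_id)
  have conjugate: "perm_mat M q = perm_mat M f * perm_mat M p * (perm_mat M g :: 'a mat)"
    by (auto simp: perm_mat_mult flt lt gf conj intro!: perm_mat_cong)
  show ?thesis
    by (rule similar_matI[OF _ inverse conjugate]) simp
qed

lemma prod_list_diag_mat_const:
  assumes "A \<in> carrier_mat k k" and "\<And>i. i < k \<Longrightarrow> A $$ (i, i) = a"
  shows "prod_list (diag_mat A) = a ^ k"
proof -
  have "diag_mat A = map (\<lambda>_. a) [0..<k]"
    using assms by (auto simp: diag_mat_def)
  then show ?thesis
    by (simp add: map_replicate_const)
qed

text \<open>The matrix is a companion matrix of \<open>t\<^sup>N - 1\<close>. The first column of \<open>t I\<close> minus the
  matrix has only two nonzero entries, \<open>t\<close> at the top and \<open>-1\<close> at the bottom, and the corresponding minors are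
  triangular, with diagonal entries \<open>t\<close> and \<open>-1\<close> respectively. For \<open>N = 1\<close> the two entries would coincide.\<close>

lemma char_poly_single_cycle:
  assumes "2 \<le> N"
  shows "char_poly (perm_mat N (\<lambda>r. Suc r mod N) :: 'a::field mat) = monom 1 N - 1"
proof -
  define A where "A = char_poly_matrix (perm_mat N (\<lambda>r. Suc r mod N) :: 'a mat)"
  have A: "A \<in> carrier_mat N N" by (simp add: A_def)
  have ent: "A $$ (r, l) = (if r = l then monom 1 1 else 0) - (if l = Suc r mod N then 1 else 0)"
    if "r < N" "l < N" for r l
    using that by (simp add: A_def char_poly_matrix_def perm_mat_def monom_altdef one_pCons)
  have Suc_mod: "Suc r mod N = (if Suc r = N then 0 else Suc r)" if "r < N" for r
    using that by auto
  have "det A = (\<Sum>i<N. A $$ (i, 0) * cofactor A i 0)"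
    using assms by (intro laplace_expansion_column[OF A]) auto
  also have "\<dots> = (\<Sum>i\<in>{0, N - 1}. A $$ (i, 0) * cofactor A i 0)"
    using assms by (intro sum.mono_neutral_right) (auto simp: ent Suc_mod)
  also have "\<dots> = monom 1 1 * cofactor A 0 0 - cofactor A (N - 1) 0"
    using assms by (simp add: ent Suc_mod)
  also have "cofactor A 0 0 = monom 1 1 ^ (N - 1)"
  proof -
    let ?B = "mat_delete A 0 0"
    have B: "?B \<in> carrier_mat (N - 1) (N - 1)"
      using mat_delete_carrier[OF A] by simp
    have entB: "?B $$ (i, j) = A $$ (Suc i, Suc j)" if "i < N - 1" "j < N - 1" for i j
      using that A by (simp add: mat_delete_def)
    have "upper_triangular ?B"
      using B A by (auto simp: upper_triangular_def entB ent Suc_mod)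
    then have "det ?B = prod_list (diag_mat ?B)"
      by (rule det_upper_triangular[OF _ B])
    also have "\<dots> = monom 1 1 ^ (N - 1)"
      by (rule prod_list_diag_mat_const[OF B]) (auto simp: entB ent Suc_mod)
    finally show ?thesis by (simp add: cofactor_def)
  qed
  also have "cofactor A (N - 1) 0 = 1"
  proof -
    define B where "B = mat_delete A (N - 1) 0"
    have B: "B \<in> carrier_mat (N - 1) (N - 1)"
      using mat_delete_carrier[OF A] by (simp add: B_def)
    have entB: "B $$ (i, j) = A $$ (i, Suc j)" if "i < N - 1" "j < N - 1" for i j
      using that A by (simp add: B_def mat_delete_def)
    have "B $$ (i, j) = 0" if "i < j" "j < N - 1" for i j
    proof -
      have "i < N - 1" "i < N" "Suc j < N" "Suc i \<noteq> N" using that by auto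
      then show ?thesis using that by (simp add: entB ent Suc_mod)
    qed
    then have "det B = prod_list (diag_mat B)"
      by (rule det_lower_triangular[OF _ B])
    also have "\<dots> = (- 1) ^ (N - 1)"
      by (rule prod_list_diag_mat_const[OF B]) (auto simp: entB ent Suc_mod)
    finally have "cofactor A (N - 1) 0 = (- 1) ^ (N - 1) * (- 1) ^ (N - 1)"
      by (simp only: cofactor_def B_def add_0_right)
    then show ?thesis
      by (simp flip: power_mult_distrib)
  qed
  also have "monom 1 1 * monom 1 1 ^ (N - 1) = (monom 1 N :: 'a poly)"
    using assms by (simp add: monom_power mult_monom)
  finally show ?thesis
    by (simp add: char_poly_def A_def)
qed

lemma char_poly_block_diagonal:
  fixes A :: "'a::field mat"
  assumes A: "A \<in> carrier_mat k k" and D: "D \<in> carrier_mat l l"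
  shows "char_poly (four_block_mat A (0\<^sub>m k l) (0\<^sub>m l k) D) = char_poly A * char_poly D"
proof -
  have "char_poly_matrix (four_block_mat A (0\<^sub>m k l) (0\<^sub>m l k) D) =
      four_block_mat (char_poly_matrix A) (0\<^sub>m k l) (0\<^sub>m l k) (char_poly_matrix D)"
    using A D by (intro eq_matI) (auto simp: char_poly_matrix_def)
  then show ?thesis
    unfolding char_poly_def
    using A D by (simp add: det_four_block_mat_lower_left_zero[of _ k _ l])
qed

text \<open>The permutation rotates each of the \<open>K\<close> consecutive blocks of \<open>N\<close> indices, so its matrix is
  block diagonal with equal blocks.\<close>

lemma char_poly_consecutive_cycles:
  assumes "2 \<le> N"
  shows "char_poly (perm_mat (K * N) (\<lambda>r. r div N * N + Suc (r mod N) mod N) :: 'a::field mat)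
    = (monom 1 N - 1) ^ K"
proof (induction K)
  case 0
  have "char_poly (perm_mat 0 p :: 'a mat) = 1" for p
    unfolding char_poly_def by (rule det_dim_zero) simp
  then show ?case by simp
next
  case (Suc K)
  let ?s = "\<lambda>r. r div N * N + Suc (r mod N) mod N"
  have lt: "?s r < K * N" if "r < K * N" for r
  proof -
    have "r div N < K" using that by (simp add: less_mult_imp_div_less)
    then have "Suc (r div N) * N \<le> K * N" by (intro mult_right_mono) auto
    moreover have "Suc (r mod N) mod N < N" using assms by simp
    ultimately show ?thesis by simp
  qed
  have last: "?s r = K * N + Suc (r - K * N) mod N" if "K * N \<le> r" "r < K * N + N" for r
  proof -
    define i where "i = r - K * N"
    have i: "r = K * N + i" "i < N"
      using that by (auto simp: i_def)
    have "r div N = K"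
      unfolding i(1) using i(2) by simp
    moreover have "r mod N = i"
      unfolding i(1) using i(2) by simp
    ultimately show ?thesis using i by simp
  qed
  have "perm_mat (Suc K * N) ?s = four_block_mat (perm_mat (K * N) ?s) (0\<^sub>m (K * N) N)
      (0\<^sub>m N (K * N)) (perm_mat N (\<lambda>r. Suc r mod N) :: 'a mat)"
  proof (rule eq_matI)
    fix r l
    assume "r < dim_row (four_block_mat (perm_mat (K * N) ?s) (0\<^sub>m (K * N) N)
      (0\<^sub>m N (K * N)) (perm_mat N (\<lambda>r. Suc r mod N) :: 'a mat))"
      "l < dim_col (four_block_mat (perm_mat (K * N) ?s) (0\<^sub>m (K * N) N)
      (0\<^sub>m N (K * N)) (perm_mat N (\<lambda>r. Suc r mod N) :: 'a mat))"
    then have rl: "r < K * N + N" "l < K * N + N" by (auto simp: perm_mat_def)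
    then show "perm_mat (Suc K * N) ?s $$ (r, l) = four_block_mat (perm_mat (K * N) ?s)
      (0\<^sub>m (K * N) N) (0\<^sub>m N (K * N)) (perm_mat N (\<lambda>r. Suc r mod N) :: 'a mat) $$ (r, l)"
    proof (cases "r < K * N")
      case True
      have "(perm_mat (Suc K * N) ?s :: 'a mat) $$ (r, l) = (if l = ?s r then 1 else 0)"
        using rl by (simp add: perm_mat_def)
      moreover have "?s r < K * N" using lt True .
      ultimately show ?thesis
        using True rl by (simp add: perm_mat_def del: mod_less_divisor)
    next
      case False
      have "(perm_mat (Suc K * N) ?s :: 'a mat) $$ (r, l) = (if l = ?s r then 1 else 0)"
        using rl by (simp add: perm_mat_def)
      moreover have "?s r = K * N + Suc (r - K * N) mod N" using last False rl by simp
      ultimately show ?thesis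
        using False rl by (auto simp: perm_mat_def)
    qed
  qed (simp_all add: perm_mat_def)
  then show ?case
    using Suc by (simp add: char_poly_block_diagonal char_poly_single_cycle[OF assms])
qed

lemma nth_concat_uniform:
  assumes "\<forall>cs \<in> set css. length cs = N" and "k < length css" and "i < N"
  shows "concat css ! (k * N + i) = css ! k ! i"
  using assms
proof (induction css arbitrary: k)
  case (Cons cs css)
  then show ?case by (cases k) (auto simp: nth_append)
qed simp

text \<open>Position \<open>r\<close> of the concatenated cycles lies in cycle \<open>r div N\<close> at place \<open>r mod N\<close>. So
  the relabelling \<open>r \<mapsto> concat css ! r\<close> turns \<open>p\<close> into the permutation of
  \<open>char_poly_consecutive_cycles\<close>.\<close>

lemma char_poly_perm_mat_disjoint_cycles:
  assumes "disjoint_cycles {..<M} p css" and len: "\<forall>cs \<in> set css. length cs = N" and "2 \<le> N"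
  shows "char_poly (perm_mat M p :: 'a::field mat) = (monom 1 N - 1) ^ length css"
proof -
  let ?K = "length css" and ?L = "concat css"
  let ?s = "\<lambda>r. r div N * N + Suc (r mod N) mod N"
  have dist: "distinct ?L" and set: "set ?L = {..<M}"
    and p: "p = foldr (\<circ>) (map cycle_of_list css) id"
    using assms(1) by (auto simp: disjoint_cycles_def)
  have M: "M = ?K * N"
  proof -
    have "M = length ?L" using distinct_card[OF dist] set by simp
    also have "\<dots> = sum_list (map length css)" by (simp add: length_concat)
    also have "map length css = map (\<lambda>_. N) css" using len by simp
    finally show ?thesis by (simp add: sum_list_triv)
  qed
  then have lenL: "length ?L = M"
    using distinct_card[OF dist] set by simp
  have bij: "bij_betw ((!) ?L) {..<M} {..<M}"
    by (rule bij_betw_nth) (use dist set lenL in auto)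
  have step: "p (?L ! r) = ?L ! ?s r" and slt: "?s r < M" and plt: "p r < M" if r: "r < M" for r
  proof -
    have k: "r div N < ?K" using r M by (simp add: less_mult_imp_div_less)
    have i: "r mod N < N" "Suc (r mod N) mod N < N" using assms(3) by auto
    let ?cs = "css ! (r div N)"
    have cs: "?cs \<in> set css" "length ?cs = N" using k len by auto
    have dcs: "distinct ?cs" using dist cs(1) by (auto simp: distinct_concat_iff)
    have Lr: "?L ! r = ?cs ! (r mod N)"
      using nth_concat_uniform[OF len k i(1)] by simp
    have "p (?cs ! (r mod N)) = cycle_of_list ?cs (?cs ! (r mod N))"
      unfolding p using dist cs i by (intro foldr_cycles_apply) auto
    also have "\<dots> = map (cycle_of_list ?cs) ?cs ! (r mod N)"
      using cs i by simp
    also have "map (cycle_of_list ?cs) ?cs = rotate1 ?cs"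
      using cyclic_rotation[OF dcs, of 1] by simp
    also have "rotate1 ?cs ! (r mod N) = ?cs ! (Suc (r mod N) mod N)"
      using cs i by (simp add: nth_rotate1)
    also have "\<dots> = ?L ! ?s r"
      using nth_concat_uniform[OF len k i(2)] by simp
    finally show "p (?L ! r) = ?L ! ?s r" using Lr by simp
    have "Suc (r div N) * N \<le> ?K * N" using k by (intro mult_right_mono) auto
    then show slt: "?s r < M" using i M by simp
    have "r \<in> set ?L" using r set by simp
    then obtain cs where cs: "cs \<in> set css" "r \<in> set cs" by auto
    then have "p r = cycle_of_list cs r"
      unfolding p using dist by (intro foldr_cycles_apply) auto
    then have "p r \<in> set cs"
      using cs(2) permutes_in_image[OF cycle_permutes] by metis
    then have "p r \<in> set ?L" using cs(1) by auto
    then show "p r < M" unfolding set by simp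
  qed
  have "similar_mat (perm_mat M ?s) (perm_mat M p :: 'a mat)"
    by (rule similar_perm_mat[of "(!) ?L" M p ?s, OF bij plt slt step])
  then have "char_poly (perm_mat M p :: 'a mat) = char_poly (perm_mat M ?s)"
    by (simp add: char_poly_similar)
  then show ?thesis
    unfolding M using char_poly_consecutive_cycles[OF assms(3)] by simp
qed

section \<open>Monomials modulo the binomial relations\<close>

text \<open>The computation in the quotient ring concerns products of variables only. It is therefore
  done for an arbitrary commutative monoid with elements \<open>x i\<close> that satisfy the binomial relations
  up to the congruence ``equal value under \<open>f\<close>''. The submonoid \<open>C\<close> stands for the polynomials in
  the variables \<open>1, \<dots>, n\<close>: only on them is equality of classes compatible with multiplication.\<close>

locale binomial_relations =
  fixes n :: nat and x :: "nat \<Rightarrow> 'b::comm_monoid_mult" and C :: "'b set" and f :: "'b \<Rightarrow> 'c"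
  assumes n_ge: "3 \<le> n"
    and one_closed [simp]: "1 \<in> C"
    and mult_closed [simp]: "\<And>p q. p \<in> C \<Longrightarrow> q \<in> C \<Longrightarrow> p * q \<in> C"
    and x_closed [simp]: "\<And>i. i \<in> {1..n} \<Longrightarrow> x i \<in> C"
    and mult_cong: "\<And>p p' q q'. p \<in> C \<Longrightarrow> p' \<in> C \<Longrightarrow> q \<in> C \<Longrightarrow> q' \<in> C \<Longrightarrow>
      f p = f p' \<Longrightarrow> f q = f q' \<Longrightarrow> f (p * q) = f (p' * q')"
    and relation: "\<And>i. i \<in> {1..n} \<Longrightarrow> f (\<Prod>k\<in>{1..n} - {i}. x k) = f (x i)"
begin

definition y :: 'b where "y = x n ^ 2"

definition monomial :: "nat \<Rightarrow> nat set \<Rightarrow> 'b" where "monomial b T = x n ^ b * (\<Prod>i\<in>T. x i)"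

text \<open>The parameters of the monomials different from 1 in \<open>x\<^sub>2, \<dots>, x\<^sub>n\<close> that are
  squarefree outside \<open>x\<^sub>n\<close>. The exponent of \<open>x\<^sub>n\<close> is not yet reduced.\<close>

definition admissible :: "nat \<Rightarrow> nat set \<Rightarrow> bool" where
  "admissible b T \<longleftrightarrow> T \<subseteq> {2..n-1} \<and> (b, T) \<noteq> (0, {})"

lemma power_closed [simp]: "p \<in> C \<Longrightarrow> p ^ k \<in> C"
  by (induction k) auto

lemma prod_closed: "T \<subseteq> {1..n} \<Longrightarrow> prod x T \<in> C"
proof -
  assume T: "T \<subseteq> {1..n}"
  then have "finite T" by (rule finite_subset) simp
  then show ?thesis using T by (induction T) auto
qed

lemma xn_closed [simp]: "x n \<in> C"
  using n_ge by simp

lemma y_closed [simp]: "y \<in> C"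
  by (simp add: y_def)

lemma params_subset: "T \<subseteq> {2..n-1} \<Longrightarrow> T \<subseteq> {1..n}"
  by (erule subset_trans) auto

lemma monomial_closed: "T \<subseteq> {2..n-1} \<Longrightarrow> monomial b T \<in> C"
  unfolding monomial_def by (intro mult_closed prod_closed params_subset) auto

lemma mult_cong_left: "p \<in> C \<Longrightarrow> q \<in> C \<Longrightarrow> r \<in> C \<Longrightarrow> f p = f q \<Longrightarrow> f (r * p) = f (r * q)"
  by (rule mult_cong) auto

lemma power_cong: "p \<in> C \<Longrightarrow> q \<in> C \<Longrightarrow> f p = f q \<Longrightarrow> f (p ^ k) = f (q ^ k)"
  by (induction k) (auto intro: mult_cong)

lemma square_eq_prod:
  assumes "i \<in> {1..n}"
  shows "f (x i ^ 2) = f (\<Prod>k\<in>{1..n}. x k)"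
proof -
  have "f (x i * x i) = f (x i * (\<Prod>k\<in>{1..n} - {i}. x k))"
    using assms by (intro mult_cong_left relation[symmetric]) (auto simp: prod_closed)
  then show ?thesis
    using assms by (simp add: power2_eq_square prod.remove)
qed

lemma square: "i \<in> {1..n} \<Longrightarrow> f (x i ^ 2) = f y"
  unfolding y_def using square_eq_prod[of i] square_eq_prod[of n] n_ge by simp

lemma prod_square:
  assumes "T \<subseteq> {1..n}"
  shows "f ((\<Prod>i\<in>T. x i) ^ 2) = f (y ^ card T)"
proof -
  have "finite T" using assms by (rule finite_subset) simp
  then show ?thesis using assms
  proof (induction T)
    case (insert i T)
    then have "f (x i ^ 2 * prod x T ^ 2) = f (y * y ^ card T)"
      by (intro mult_cong) (auto simp: square prod_closed)
    then show ?case using insert by (simp add: power_mult_distrib)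
  qed simp
qed

text \<open>For \<open>k \<noteq> i\<close> let \<open>u\<close> be the product of the remaining \<open>n - 2\<close> variables. The relations read
  \<open>x\<^sub>i = x\<^sub>k u\<close> and \<open>x\<^sub>k = x\<^sub>i u\<close>, so \<open>x\<^sub>i = x\<^sub>i u\<^sup>2\<close>, and \<open>u\<^sup>2\<close> is a product of \<open>n - 2\<close> squares.\<close>

lemma y_power_fixes_x:
  assumes i: "i \<in> {1..n}"
  shows "f (x i * y ^ (n - 2)) = f (x i)"
proof -
  \<comment> \<open>Any index other than \<open>i\<close> will do.\<close>
  define k where "k = (if i = 1 then 2 else 1 :: nat)"
  have k: "k \<in> {1..n}" "k \<noteq> i" using n_ge i by (auto simp: k_def)
  define U where "U = {1..n} - {i} - {k}"
  have U: "U \<subseteq> {1..n}" "card U = n - 2" "finite U"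
    using i k by (auto simp: U_def)
  have iU: "prod x ({1..n} - {i}) = x k * prod x U"
    using i k unfolding U_def by (subst prod.remove[of _ k]) auto
  have "{1..n} - {k} - {i} = U" by (auto simp: U_def)
  then have kU: "prod x ({1..n} - {k}) = x i * prod x U"
    using i k by (subst prod.remove[of _ i]) auto
  have "f (x i) = f (x k * prod x U)"
    using relation[OF i] iU by simp
  also have "\<dots> = f ((x i * prod x U) * prod x U)"
    using relation[OF k(1)] kU i k U by (intro mult_cong) (auto simp: prod_closed)
  also have "\<dots> = f (x i * prod x U ^ 2)"
    by (simp add: power2_eq_square mult.assoc)
  also have "\<dots> = f (x i * y ^ (n - 2))"
    using prod_square[OF U(1)] U i by (intro mult_cong_left) (auto simp: prod_closed)
  finally show ?thesis by simp
qed

lemma monomial_has_factor: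
  assumes "admissible b T"
  shows "\<exists>i\<in>{1..n}. \<exists>q\<in>C. monomial b T = x i * q"
proof (cases "T = {}")
  case True
  then obtain b' where "b = Suc b'" using assms by (cases b) (auto simp: admissible_def)
  then show ?thesis
    using True n_ge by (intro bexI[of _ n] bexI[of _ "x n ^ b'"]) (auto simp: monomial_def)
next
  case False
  then obtain i where i: "i \<in> T" by blast
  have T: "T \<subseteq> {2..n-1}" "finite T"
    using assms finite_subset by (auto simp: admissible_def)
  have "monomial b T = x i * (x n ^ b * prod x (T - {i}))"
    using i T by (simp add: monomial_def prod.remove ac_simps)
  moreover have "prod x (T - {i}) \<in> C" using params_subset[OF T(1)] by (intro prod_closed) auto
  ultimately show ?thesis
    using i params_subset[OF T(1)] by (intro bexI[of _ i] bexI[of _ "x n ^ b * prod x (T - {i})"]) auto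
qed

text \<open>A monomial different from 1 contains some variable, which absorbs \<open>y\<^bsup>n-2\<^esup>\<close>.\<close>

lemma y_power_fixes_monomial:
  assumes "admissible b T"
  shows "f (monomial b T * y ^ ((n - 2) * t)) = f (monomial b T)"
proof (induction t)
  case (Suc t)
  obtain i q where iq: "i \<in> {1..n}" "q \<in> C" "monomial b T = x i * q"
    using monomial_has_factor[OF assms] by blast
  have "f (monomial b T * y ^ ((n - 2) * Suc t)) =
      f (q * y ^ ((n - 2) * t) * (x i * y ^ (n - 2)))"
    by (simp add: iq power_add ac_simps)
  also have "\<dots> = f (q * y ^ ((n - 2) * t) * x i)"
    using iq by (intro mult_cong_left y_power_fixes_x) auto
  also have "\<dots> = f (monomial b T * y ^ ((n - 2) * t))"
    by (simp add: iq ac_simps)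
  finally show ?case using Suc by simp
qed simp

lemma monomial_add_period:
  assumes "admissible b T"
  shows "f (monomial (b + 2 * (n - 2) * t) T) = f (monomial b T)"
proof -
  have "x n ^ (2 * (n - 2) * t) = y ^ ((n - 2) * t)"
    by (simp add: y_def power_mult flip: power_mult mult.assoc)
  then have "monomial (b + 2 * (n - 2) * t) T = monomial b T * y ^ ((n - 2) * t)"
    unfolding monomial_def power_add by (simp add: ac_simps)
  then show ?thesis using y_power_fixes_monomial[OF assms] by simp
qed

lemma x_mult_monomial_mid:
  assumes T: "T \<subseteq> {2..n-1}" and i: "i \<in> {2..n}"
  shows "\<exists>b' T'. admissible b' T' \<and> f (x i * monomial b T) = f (monomial b' T')"
proof -
  have fin: "finite T" using T by (rule finite_subset) simp
  consider "i = n" | "i \<noteq> n" "i \<notin> T" | "i \<in> T" by blast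
  then show ?thesis
  proof cases
    case 1
    then show ?thesis
      using T by (intro exI[of _ "Suc b"] exI[of _ T]) (simp add: admissible_def monomial_def ac_simps)
  next
    case 2
    then show ?thesis
      using T i fin
      by (intro exI[of _ b] exI[of _ "insert i T"]) (auto simp: admissible_def monomial_def ac_simps)
  next
    case 3
    have c: "prod x (T - {i}) \<in> C" using params_subset[OF T] by (intro prod_closed) auto
    have "x i * monomial b T = x n ^ b * prod x (T - {i}) * x i ^ 2"
      using 3 fin by (simp add: monomial_def prod.remove power2_eq_square ac_simps)
    also have "f \<dots> = f (x n ^ b * prod x (T - {i}) * y)"
      using 3 params_subset[OF T] c by (intro mult_cong_left square) auto
    also have "x n ^ b * prod x (T - {i}) * y = monomial (b + 2) (T - {i})"
      unfolding monomial_def y_def power_add by (simp add: ac_simps)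
    finally show ?thesis
      using T by (intro exI[of _ "b + 2"] exI[of _ "T - {i}"]) (auto simp: admissible_def)
  qed
qed

lemma prod_mult_monomial:
  assumes "finite U" "U \<subseteq> {2..n}" "admissible b T"
  shows "\<exists>b' T'. admissible b' T' \<and> f (prod x U * monomial b T) = f (monomial b' T')"
  using assms
proof (induction U)
  case empty
  then show ?case by auto
next
  case (insert i U)
  then obtain b' T' where *: "admissible b' T'" "f (prod x U * monomial b T) = f (monomial b' T')"
    by auto
  have T: "T \<subseteq> {2..n-1}" "T' \<subseteq> {2..n-1}" using insert.prems * by (auto simp: admissible_def)
  have U: "U \<subseteq> {1..n}" using insert.prems by auto
  have "f (prod x (insert i U) * monomial b T) = f (x i * (prod x U * monomial b T))"
    using insert by (simp add: ac_simps)
  also have "\<dots> = f (x i * monomial b' T')"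
    using insert.prems T U * by (intro mult_cong_left) (auto simp: prod_closed monomial_closed)
  finally show ?case using x_mult_monomial_mid[OF T(2), of i] insert.prems by auto
qed

text \<open>The first variable is replaced by the product of all others, which reduces the claim
  to \<open>x_mult_monomial_mid\<close>.\<close>

lemma x_mult_monomial:
  assumes "i \<in> {1..n}" "admissible b T"
  shows "\<exists>b' T'. admissible b' T' \<and> f (x i * monomial b T) = f (monomial b' T')"
proof (cases "i = 1")
  case False
  then show ?thesis using assms x_mult_monomial_mid[of T i b] by (auto simp: admissible_def)
next
  case True
  have T: "T \<subseteq> {2..n-1}" using assms by (simp add: admissible_def)
  have "{1..n} - {1} = {2..n}" by auto
  then have "f (x 1 * monomial b T) = f (prod x {2..n} * monomial b T)"
    using relation[of 1] n_ge T by (intro mult_cong) (auto simp: monomial_closed prod_closed)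
  then show ?thesis using True prod_mult_monomial[of "{2..n}" b T] assms by auto
qed

lemma x_period:
  assumes j: "j \<in> {1..n}" and bT: "admissible b T"
  shows "f (x j ^ (2 * (n - 2)) * monomial b T) = f (monomial b T)"
proof -
  have T: "T \<subseteq> {2..n-1}" using bT by (simp add: admissible_def)
  have "f ((x j ^ 2) ^ (n - 2)) = f (y ^ (n - 2))"
    using j by (intro power_cong square) auto
  then have "f (monomial b T * x j ^ (2 * (n - 2))) = f (monomial b T * y ^ (n - 2))"
    using j T by (intro mult_cong_left) (auto simp: power_mult monomial_closed)
  also have "\<dots> = f (monomial b T)" using y_power_fixes_monomial[OF bT, of 1] by simp
  finally show ?thesis by (simp add: mult.commute)
qed

lemma y_power_eq_monomial: "y ^ k = monomial (2 * k) {}"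
  by (simp add: monomial_def y_def power_mult)

lemma monomial_square:
  assumes "T \<subseteq> {2..n-1}"
  shows "f (monomial b T * monomial b T) = f (y ^ (b + card T))"
proof -
  have T: "T \<subseteq> {1..n}" using assms by (rule params_subset)
  have "f (x n ^ b * x n ^ b * prod x T ^ 2) = f (y ^ b * y ^ card T)"
    using prod_square[OF T] T
    by (intro mult_cong) (auto simp: prod_closed y_def power2_eq_square power_mult_distrib)
  then show ?thesis by (simp add: monomial_def power_add power2_eq_square ac_simps)
qed

text \<open>If the square of the monomial \<open>p\<close> is \<open>y\<^sup>s\<close> with \<open>s > 0\<close>, then \<open>p\<close> times \<open>p y\<^bsup>(n-3)s\<^esup>\<close> is
  \<open>y\<^bsup>(n-2)s\<^esup>\<close>, and this is the identity \<open>y\<^bsup>n-2\<^esup>\<close>.\<close>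

lemma monomial_inverse:
  assumes "admissible b T"
  shows "\<exists>q\<in>C. f (monomial b T * q) = f (y ^ (n - 2))"
proof -
  have T: "T \<subseteq> {2..n-1}" using assms by (simp add: admissible_def)
  then have fin: "finite T" by (rule finite_subset) simp
  define s where "s = b + card T"
  have "s \<noteq> 0" using assms fin by (auto simp: s_def admissible_def)
  then obtain t where t: "s = Suc t" by (cases s) auto
  have "(n - 2) * s = s + (n - 3) * s"
    using n_ge by (metis Suc_diff_le add_mult_distrib numeral_3_eq_3 diff_Suc_Suc numeral_2_eq_2 plus_1_eq_Suc mult_1)
  then have exponent: "s + (n - 3) * s = (n - 2) + (n - 2) * t"
    using t by simp
  let ?q = "monomial b T * y ^ ((n - 3) * s)"
  have q: "?q \<in> C" using T by (simp add: monomial_closed)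
  have "f (monomial b T * ?q) = f (y ^ ((n - 3) * s) * (monomial b T * monomial b T))"
    by (simp add: ac_simps)
  also have "\<dots> = f (y ^ ((n - 3) * s) * y ^ s)"
    using T monomial_square[OF T, of b] by (intro mult_cong_left) (auto simp: s_def monomial_closed)
  also have "y ^ ((n - 3) * s) * y ^ s = y ^ (n - 2) * y ^ ((n - 2) * t)"
    using exponent by (simp flip: power_add add: add.commute)
  also have "f \<dots> = f (y ^ (n - 2))"
    using y_power_fixes_monomial[of "2 * (n - 2)" "{}" t] n_ge
    by (simp add: admissible_def y_power_eq_monomial)
  finally show ?thesis using q by blast
qed

text \<open>This is cancellation in the group of nontrivial monomials.\<close>

lemma fixed_imp_power_eq_unit:
  assumes j: "j \<in> {1..n}" and bT: "admissible b T" and k: "0 < k"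
    and fixed: "f (x j ^ k * monomial b T) = f (monomial b T)"
  shows "f (x j ^ k) = f (y ^ (n - 2))"
proof -
  have T: "T \<subseteq> {2..n-1}" using bT by (simp add: admissible_def)
  obtain q where q: "q \<in> C" "f (monomial b T * q) = f (y ^ (n - 2))"
    using monomial_inverse[OF bT] by blast
  obtain k' where k': "k = Suc k'" using k by (cases k) auto
  have "f (x j ^ k) = f (x j ^ k' * (x j * y ^ (n - 2)))"
    unfolding k' power_Suc2 using j y_power_fixes_x[OF j] by (intro mult_cong_left) auto
  also have "\<dots> = f (x j ^ k * y ^ (n - 2))"
    by (simp add: k' ac_simps)
  also have "\<dots> = f (x j ^ k * (monomial b T * q))"
    using j q T by (intro mult_cong_left) (auto simp: monomial_closed)
  also have "\<dots> = f (q * (x j ^ k * monomial b T))"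
    by (simp add: ac_simps)
  also have "\<dots> = f (q * monomial b T)"
    using fixed j q T by (intro mult_cong_left) (auto simp: monomial_closed)
  also have "\<dots> = f (y ^ (n - 2))" using q by (simp add: mult.commute)
  finally show ?thesis .
qed

text \<open>An even power is a power of \<open>y = x\<^sub>n\<^sup>2\<close>. An odd power has one more factor \<open>x\<^sub>j\<close>, and for
  \<open>j = 1\<close> this factor is \<open>x\<^sub>2 \<cdots> x\<^sub>n\<close>. In no case does the exponent of \<open>x\<^sub>n\<close> exceed \<open>k\<close>.\<close>

lemma x_power_normal_form:
  assumes j: "j \<in> {1..n}" and k: "k < 2 * n - 4"
  shows "\<exists>b T. T \<subseteq> {2..n-1} \<and> b < 2 * n - 4 \<and> f (x j ^ k) = f (monomial b T)"
proof -
  define l where "l = k div 2"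
  have pw: "f ((x j ^ 2) ^ l) = f (y ^ l)"
    using j by (intro power_cong square) auto
  show ?thesis
  proof (cases "even k")
    case True
    then have "k = 2 * l" by (simp add: l_def)
    then show ?thesis
      using pw k by (intro exI[of _ k] exI[of _ "{}"]) (simp add: power_mult y_power_eq_monomial)
  next
    case False
    then have kl: "k = Suc (2 * l)" by (simp add: l_def)
    have xk: "f (x j ^ k) = f (x j * y ^ l)"
      using pw j unfolding kl power_Suc by (intro mult_cong_left) (auto simp: power_mult)
    consider "j = n" | "j \<in> {2..n-1}" | "j = 1" using j by force
    then show ?thesis
    proof cases
      case 1
      then show ?thesis
        using k by (intro exI[of _ k] exI[of _ "{}"]) (simp add: monomial_def)
    next
      case 2
      then show ?thesis
        using k kl xk
        by (intro exI[of _ "2 * l"] exI[of _ "{j}"]) (auto simp: monomial_def y_power_eq_monomial ac_simps)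
    next
      case 3
      have "{1..n} - {1} = insert n {2..n-1}" using n_ge by auto
      moreover have "prod x (insert n {2..n-1}) = x n * prod x {2..n-1}"
        using n_ge by (intro prod.insert) auto
      ultimately have "f (x 1) = f (x n * prod x {2..n-1})"
        using relation[of 1] n_ge by simp
      then have "f (y ^ l * x 1) = f (y ^ l * (x n * prod x {2..n-1}))"
        using n_ge by (intro mult_cong_left) (auto intro!: prod_closed mult_closed)
      also have "y ^ l * (x n * prod x {2..n-1}) = monomial k {2..n-1}"
        by (simp add: monomial_def y_power_eq_monomial kl ac_simps)
      finally show ?thesis
        using xk 3 k by (intro exI[of _ k] exI[of _ "{2..n-1}"]) (auto simp: mult.commute)
    qed
  qed
qed

text \<open>The index set of the monomial basis. The pair \<open>(2 * n - 4, {})\<close> belongs to the identity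
  element of the group of nontrivial monomials, and \<open>(0, {})\<close> to the monomial 1.\<close>

definition normal_params :: "(nat \<times> nat set) set" where
  "normal_params = {..<2 * n - 4} \<times> Pow {2..n-1} \<union> {(2 * n - 4, {})}"

abbreviation val :: "nat \<times> nat set \<Rightarrow> 'c" where
  "val \<equiv> \<lambda>(b, T). f (monomial b T)"

lemma card_normal_params: "card normal_params = 1 + (n - 2) * 2 ^ (n - 1)"
proof -
  have "card normal_params = card ({..<2 * n - 4} \<times> Pow {2..n-1}) + 1"
    unfolding normal_params_def by (subst card_Un_disjoint) auto
  also have "card ({..<2 * n - 4} \<times> Pow {2..n-1}) = (2 * n - 4) * 2 ^ (n - 2)"
    using n_ge by (simp add: card_cartesian_product card_Pow)
  also have "\<dots> = (n - 2) * 2 ^ Suc (n - 2)"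
    by (simp add: diff_mult_distrib)
  also have "Suc (n - 2) = n - 1" using n_ge by simp
  finally show ?thesis by simp
qed

lemma finite_normal_params: "finite normal_params"
  by (simp add: normal_params_def)

text \<open>The exponent of \<open>x\<^sub>n\<close> can be reduced modulo \<open>2(n-2)\<close>, except that a pure power of
  \<open>x\<^sub>n\<close> must not become 1: exponents divisible by the period are reduced to the period itself.\<close>

lemma nontrivial_params:
  "val ` (normal_params - {(0, {})}) = {f (monomial b T) |b T. admissible b T}"
proof (intro equalityI subsetI)
  fix v assume "v \<in> val ` (normal_params - {(0, {})})"
  then show "v \<in> {f (monomial b T) |b T. admissible b T}"
    using n_ge by (auto simp: normal_params_def admissible_def)
next
  fix v assume "v \<in> {f (monomial b T) |b T. admissible b T}"
  then obtain b T where bT: "admissible b T" and v: "v = f (monomial b T)" by blast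
  define N where "N = 2 * (n - 2)"
  have N: "N = 2 * n - 4" "N > 0" using n_ge by (auto simp: N_def)
  have T: "T \<subseteq> {2..n-1}" using bT by (simp add: admissible_def)
  show "v \<in> val ` (normal_params - {(0, {})})"
  proof (cases "b mod N = 0 \<and> T = {}")
    case True
    then obtain t where t: "b = N * t" by auto
    have "t \<noteq> 0" using True t bT by (auto simp: admissible_def intro: ccontr)
    then obtain t' where "t = Suc t'" by (cases t) auto
    then have "v = f (monomial N {})"
      using v t True monomial_add_period[of N "{}" t'] N by (simp add: admissible_def N_def)
    then show ?thesis
      using N by (intro image_eqI[of _ _ "(N, {})"]) (auto simp: normal_params_def)
  next
    case False
    then have "admissible (b mod N) T" using T by (auto simp: admissible_def)
    then have "f (monomial (b mod N + N * (b div N)) T) = f (monomial (b mod N) T)"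
      unfolding N_def by (rule monomial_add_period)
    then show ?thesis
      using v N T False mod_less_divisor[of N b]
      by (intro image_eqI[of _ _ "(b mod N, T)"]) (auto simp: normal_params_def)
  qed
qed

text \<open>Otherwise \<open>x\<^sub>j\<^sup>k\<close> would be the identity \<open>x\<^sub>n\<^bsup>2n-4\<^esup>\<close>, but both have normal forms and these
  differ in the exponent of \<open>x\<^sub>n\<close>.\<close>

lemma x_power_moves:
  assumes inj: "inj_on val normal_params"
    and j: "j \<in> {1..n}" and bT: "admissible b T" and k: "0 < k" "k < 2 * (n - 2)"
  shows "f (x j ^ k * monomial b T) \<noteq> f (monomial b T)"
proof
  assume "f (x j ^ k * monomial b T) = f (monomial b T)"
  then have 1: "f (x j ^ k) = f (monomial (2 * n - 4) {})"
    using fixed_imp_power_eq_unit[OF j bT k(1)] by (simp add: y_power_eq_monomial diff_mult_distrib2)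
  have "k < 2 * n - 4" using k by simp
  then obtain b' T' where 2: "T' \<subseteq> {2..n-1}" "b' < 2 * n - 4" "f (x j ^ k) = f (monomial b' T')"
    using x_power_normal_form[OF j] by blast
  have "(b', T') = (2 * n - 4, {})"
    by (rule inj_onD[OF inj]) (use 1 2 in \<open>auto simp: normal_params_def\<close>)
  then show False using 2 by simp
qed

end

section \<open>The quotient ring\<close>

lemma poly_ring_simps:
  "\<one>\<^bsub>poly_ring n\<^esub> = 1" "\<zero>\<^bsub>poly_ring n\<^esub> = 0"
  "p \<otimes>\<^bsub>poly_ring n\<^esub> q = p * q" "p \<oplus>\<^bsub>poly_ring n\<^esub> q = p + q"
  by (simp_all add: poly_ring_def)

lemma one_in_poly_ring: "1 \<in> carrier (poly_ring n :: 'a::field mpoly ring)"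
  by (simp add: poly_ring_def)

lemma mult_in_poly_ring:
  fixes p q :: "'a::field mpoly"
  assumes "p \<in> carrier (poly_ring n)" and "q \<in> carrier (poly_ring n)"
  shows "p * q \<in> carrier (poly_ring n)"
proof -
  have "Poly_Mapping.keys w \<subseteq> {1..n}" if w: "w \<in> Poly_Mapping.keys (p * q)" for w
  proof -
    obtain u v where uv: "w = u + v" "u \<in> Poly_Mapping.keys p" "v \<in> Poly_Mapping.keys q"
      using w keys_mult[of p q] by blast
    then have "Poly_Mapping.keys u \<subseteq> {1..n}" "Poly_Mapping.keys v \<subseteq> {1..n}"
      using assms by (auto simp: poly_ring_def)
    then show ?thesis
      using keys_add[of u v] uv(1) by blast
  qed
  then show ?thesis by (simp add: poly_ring_def)
qed

lemma add_in_poly_ring: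
  fixes p q :: "'a::field mpoly"
  assumes "p \<in> carrier (poly_ring n)" and "q \<in> carrier (poly_ring n)"
  shows "p + q \<in> carrier (poly_ring n)"
  using assms Poly_Mapping.keys_add[of p q] unfolding poly_ring_def by auto

lemma uminus_in_poly_ring:
  fixes p :: "'a::field mpoly"
  shows "p \<in> carrier (poly_ring n) \<Longrightarrow> - p \<in> carrier (poly_ring n)"
  by (simp add: poly_ring_def)

lemma X_in_poly_ring: "i \<in> {1..n} \<Longrightarrow> (X i :: 'a::field mpoly) \<in> carrier (poly_ring n)"
  by (simp add: poly_ring_def X_def)

lemma cring_poly_ring: "cring (poly_ring n :: 'a::field mpoly ring)"
proof (rule cringI)
  show "abelian_group (poly_ring n :: 'a mpoly ring)"
  proof (rule abelian_groupI; unfold poly_ring_simps)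
    show "0 \<in> carrier (poly_ring n :: 'a mpoly ring)" by (simp add: poly_ring_def)
    show "\<exists>q\<in>carrier (poly_ring n). q + p = 0"
      if "p \<in> carrier (poly_ring n)" for p :: "'a mpoly"
      using uminus_in_poly_ring[OF that] by (intro bexI[of _ "- p"]) auto
  qed (auto simp: add_in_poly_ring ac_simps)
  show "comm_monoid (poly_ring n :: 'a mpoly ring)"
    by (rule comm_monoidI; unfold poly_ring_simps)
      (auto simp: one_in_poly_ring mult_in_poly_ring ac_simps)
qed (simp add: poly_ring_simps distrib_right)

lemma prod_X_in_poly_ring:
  "S \<subseteq> {1..n} \<Longrightarrow> (\<Prod>i\<in>S. X i :: 'a::field mpoly) \<in> carrier (poly_ring n)"
proof (induction S rule: infinite_finite_induct)
  case (insert i S)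
  then show ?case by (auto intro!: mult_in_poly_ring X_in_poly_ring)
qed (auto simp: one_in_poly_ring)

lemma minus_in_poly_ring:
  fixes p q :: "'a::field mpoly"
  shows "p \<in> carrier (poly_ring n) \<Longrightarrow> q \<in> carrier (poly_ring n) \<Longrightarrow> p - q \<in> carrier (poly_ring n)"
  using add_in_poly_ring[of p n "- q"] uminus_in_poly_ring[of q n] by simp

lemma generators_in_poly_ring:
  "{(\<Prod>k\<in>{1..n} - {i}. X k) - X i |i. i \<in> {1..n}} \<subseteq> carrier (poly_ring n :: 'a::field mpoly ring)"
  by (auto intro!: minus_in_poly_ring prod_X_in_poly_ring X_in_poly_ring)

lemma ideal_I_ideal: "ideal (I_ideal n) (poly_ring n :: 'a::field mpoly ring)"
proof -
  interpret cring "poly_ring n :: 'a mpoly ring" by (rule cring_poly_ring)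
  show ?thesis
    unfolding I_ideal_def by (rule genideal_ideal[OF generators_in_poly_ring])
qed

lemma cls_mult:
  fixes p q :: "'a::field mpoly"
  assumes "p \<in> carrier (poly_ring n)" and "q \<in> carrier (poly_ring n)"
  shows "cls n p \<otimes>\<^bsub>quot_ring n\<^esub> cls n q = cls n (p * q)"
  using ideal.rcoset_mult_add[OF ideal_I_ideal assms]
  by (simp add: cls_def quot_ring_def FactRing_def poly_ring_simps)

lemma cls_relation:
  assumes i: "i \<in> {1..n}"
  shows "cls n (\<Prod>k\<in>{1..n} - {i}. X k) = cls n (X i :: 'a::field mpoly)"
proof -
  interpret R: cring "poly_ring n :: 'a mpoly ring" by (rule cring_poly_ring)
  let ?p = "(\<Prod>k\<in>{1..n} - {i}. X k) :: 'a mpoly"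
  have p: "?p \<in> carrier (poly_ring n)" by (intro prod_X_in_poly_ring) auto
  have x: "(X i :: 'a mpoly) \<in> carrier (poly_ring n)" by (rule X_in_poly_ring[OF i])
  have "\<ominus>\<^bsub>poly_ring n\<^esub> X i = (- X i :: 'a mpoly)"
    by (rule R.minus_equality) (use x uminus_in_poly_ring[OF x] in \<open>simp_all add: poly_ring_simps\<close>)
  then have "?p \<ominus>\<^bsub>poly_ring n\<^esub> X i = ?p - X i"
    by (simp add: a_minus_def poly_ring_simps)
  moreover have "?p - X i \<in> I_ideal n"
    unfolding I_ideal_def by (rule subsetD[OF R.genideal_self[OF generators_in_poly_ring]]) (use i in blast)
  ultimately show ?thesis
    unfolding cls_def using R.quotient_eq_iff_same_a_r_cos[OF ideal_I_ideal p x] by simp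
qed

lemma binomial_relations_cls:
  assumes "3 \<le> n"
  shows "binomial_relations n X (carrier (poly_ring n :: 'a::field mpoly ring)) (cls n)"
proof
  fix p p' q q' :: "'a mpoly"
  assume "p \<in> carrier (poly_ring n)" "p' \<in> carrier (poly_ring n)"
    "q \<in> carrier (poly_ring n)" "q' \<in> carrier (poly_ring n)" "cls n p = cls n p'" "cls n q = cls n q'"
  then show "cls n (p * q) = cls n (p' * q')"
    by (metis cls_mult)
qed (use assms in \<open>simp_all add: one_in_poly_ring mult_in_poly_ring X_in_poly_ring cls_relation
  flip: One_nat_def\<close>)

section \<open>Multiplication by a variable as a permutation\<close>

lemma THE_preimage:
  assumes "bij_betw m S T" and "v \<in> T"
  shows "(THE l. l \<in> S \<and> v = m l) \<in> S" and "m (THE l. l \<in> S \<and> v = m l) = v"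
proof -
  have "\<exists>!l. l \<in> S \<and> v = m l"
    using assms unfolding bij_betw_def inj_on_def by blast
  from theI'[OF this] show "(THE l. l \<in> S \<and> v = m l) \<in> S" "m (THE l. l \<in> S \<and> v = m l) = v"
    by auto
qed

theorem proposition2p5:
  fixes n j :: nat and m :: "nat \<Rightarrow> 'a::field mpoly set"
  assumes "n \<ge> 3" and "1 \<le> j" and "j \<le> n"
    and "bij_betw m {..<c n - 1} (B' n)"
  shows "(\<sigma> n m j permutes {..<c n - 1}) \<and>
    (\<forall>r < c n - 1. mult_map n j (m r) = m (\<sigma> n m j r)) \<and>
    (\<exists>css. disjoint_cycles {..<c n - 1} (\<sigma> n m j) css \<and>
           length css = 2^(n-2) \<and> (\<forall>cs \<in> set css. length cs = 2*(n-2))) \<and>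
    (P n m j \<in> Units (ring_mat TYPE('a) (c n - 1) ())) \<and>
    (mat_order (c n - 1) (P n m j) = 2*(n-2)) \<and>
    (char_poly (P n m j) = (monom 1 (2*(n-2)) - 1) ^ (2^(n-2)))"
proof -
  interpret binomial_relations n X "carrier (poly_ring n :: 'a mpoly ring)" "cls n"
    by (rule binomial_relations_cls[OF assms(1)])
  define M where "M = c n - 1"
  define N where "N = 2 * (n - 2)"
  let ?s = "\<sigma> n m j"
  have j: "j \<in> {1..n}" using assms(2,3) by simp
  have N: "2 \<le> N" using assms(1) by (simp add: N_def)
  have Suc_n: "Suc (n - 2) = n - 1" using assms(1) by simp
  have MN: "M = N * 2 ^ (n - 2)"
    unfolding M_def N_def c_def Suc_n[symmetric] by simp
  then have M: "0 < M" using N by simp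

  have monomial_eq: "monomial b T = basis_monomial n b T" for b T
    by (simp add: monomial_def basis_monomial_def)
  have B: "B n = val ` normal_params"
    unfolding B_def normal_params_def monomial_eq by (auto simp: image_iff)
  have zero: "(0, {}) \<in> normal_params" "val (0, {}) = cls n 1"
    using assms(1) by (auto simp: normal_params_def monomial_def)
  \<comment> \<open>The enumeration leaves no room for two normal forms with the same class.\<close>
  have "card (B' n :: 'a mpoly set set) = c n - 1"
    using bij_betw_same_card[OF assms(4)] by simp
  moreover have "cls n 1 \<in> val ` normal_params"
    using zero by (metis image_eqI)
  ultimately have "card (val ` normal_params) - 1 = c n - 1"
    unfolding B'_def B by (simp only: card_Diff_singleton)
  then have "card (val ` normal_params) = card normal_params"
    using M unfolding M_def card_normal_params c_def by linarith
  then have inj: "inj_on val normal_params"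
    by (rule eq_card_imp_inj_on[OF finite_normal_params])
  have B': "B' n = {cls n (monomial b T) |b T. admissible b T}"
  proof -
    have "B' n = val ` normal_params - val ` {(0, {})}"
      unfolding B'_def B using zero(2) by simp
    also have "\<dots> = val ` (normal_params - {(0, {})})"
      using inj_on_image_set_diff[OF inj, of normal_params "{(0, {})}"] zero(1) by simp
    finally show ?thesis by (simp only: nontrivial_params)
  qed

  have act: "(mult_map n j ^^ k) (cls n p) = cls n (X j ^ k * p)"
    if "p \<in> carrier (poly_ring n)" for k and p :: "'a mpoly"
    using that j by (induction k) (auto simp: mult_map_def cls_mult ac_simps)
  have mB: "m r \<in> B' n" if "r < M" for r
    using that bij_betwE[OF assms(4)] by (simp add: M_def)
  have "mult_map n j v \<in> B' n" if v: "v \<in> B' n" for v :: "'a mpoly set"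
  proof -
    obtain b T where bT: "admissible b T" "v = cls n (monomial b T)"
      using v B' by auto
    then have "mult_map n j v = cls n (X j * monomial b T)"
      using act[of "monomial b T" 1] by (simp add: monomial_closed admissible_def)
    then show ?thesis using x_mult_monomial[OF j bT(1)] B' by auto
  qed
  then have \<sigma>: "?s r < M" "m (?s r) = mult_map n j (m r)" if "r < M" for r
    using THE_preimage[OF assms(4), of "mult_map n j (m r)"] mB[OF that] that
    by (simp_all add: \<sigma>_def M_def)
  have lt: "(?s ^^ k) r < M" if "r < M" for k r
    using that \<sigma>(1) by (induction k) auto
  have iter: "m ((?s ^^ k) r) = (mult_map n j ^^ k) (m r)" if "r < M" for k r
    using that lt by (induction k) (auto simp: \<sigma>(2))
  have inj_m: "m r = m l \<longleftrightarrow> r = l" if "r < M" "l < M" for r l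
    using that assms(4) by (auto simp: bij_betw_def inj_on_def M_def)

  have period: "(?s ^^ N) r = r"
    and moves: "0 < k \<Longrightarrow> k < N \<Longrightarrow> (?s ^^ k) r \<noteq> r" if r: "r < M" for r k
  proof -
    obtain b T where bT: "admissible b T" "m r = cls n (monomial b T)"
      using mB[OF r] B' by auto
    then have "monomial b T \<in> carrier (poly_ring n)" by (simp add: monomial_closed admissible_def)
    then have *: "(?s ^^ k) r = r \<longleftrightarrow> cls n (X j ^ k * monomial b T) = cls n (monomial b T)" for k
      using inj_m[OF lt[OF r, of k] r] iter[OF r, of k] act[of "monomial b T" k] bT by simp
    show "(?s ^^ N) r = r" unfolding * N_def by (rule x_period[OF j bT(1)])
    show "(?s ^^ k) r \<noteq> r" if "0 < k" "k < N"
      unfolding * using that by (intro x_power_moves[OF inj j bT(1)]) (simp_all add: N_def)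
  qed
  have free: "(?s ^^ k) r = r \<longleftrightarrow> N dvd k" if r: "r < M" for r k
  proof -
    have "(?s ^^ (N * t)) r = r" for t
      by (induction t) (simp_all add: funpow_add period[OF r])
    then have "(?s ^^ k) r = (?s ^^ (k mod N)) r"
      using mod_mult_div_eq[of k N] by (metis comp_apply funpow_add)
    moreover have "k mod N < N" using N by simp
    ultimately show ?thesis
      using moves[OF r, of "k mod N"] by (cases "k mod N = 0") (auto simp: dvd_eq_mod_eq_0)
  qed
  have perm: "?s permutes {..<M}"
  proof (rule bij_imp_permutes)
    \<comment> \<open>The inverse of the permutation is its power with exponent \<open>N - 1\<close>.\<close>
    obtain N' where N': "N = Suc N'" using N by (cases N) auto
    show "bij_betw ?s {..<M} {..<M}"
      by (rule bij_betw_byWitness[where f' = "?s ^^ N'"])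
        (use period lt \<sigma>(1) in \<open>auto simp: N' funpow_swap1\<close>)
  qed (simp add: \<sigma>_def M_def)

  obtain css where css: "disjoint_cycles {..<M} ?s css" "N * length css = M"
      "\<forall>cs \<in> set css. length cs = N"
    using free_permutation_cycles[OF perm, of N] free N by auto
  then have len: "length css = 2 ^ (n - 2)" using MN N by auto
  have P: "P n m j = perm_mat M ?s"
    by (simp add: P_def perm_mat_def M_def)
  have "(P n m j :: 'a mat) \<in> Units (ring_mat TYPE('a) M ())"
    unfolding P by (rule perm_mat_in_Units[OF perm])
  moreover have "mat_order M (P n m j) = N"
    unfolding P by (rule mat_order_perm_mat[OF perm M free])
  moreover have "char_poly (P n m j) = (monom 1 N - 1) ^ (2 ^ (n - 2))"
    unfolding P len[symmetric] by (rule char_poly_perm_mat_disjoint_cycles[OF css(1,3) N])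
  ultimately show ?thesis
    using perm \<sigma>(2) css len unfolding M_def[symmetric] N_def[symmetric] by auto
qed

end
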